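(* There is a deterministic leader election algorithm with advice such that, for every integer $D\ge 2$ and every non-symmetric tree $T$ with at least two nodes and diameter $diam(T)\le D$, the algorithm solves leader election in $T$ in time $diam(T)-1$ using advice of size $O(\log D)$ (with an absolute implied constant). In particular $\xi(T)\le diam(T)-1$ for every non-symmetric tree $T$ with at least two nodes.
   Context: Trees are finite, undirected and anonymous (nodes have no labels), and are port-numbered: at each node $v$ of degree $d$ the incident edges carry distinct port numbers from $\{0,\dots,d-1\}$; there is no relation between the two port numbers of an edge at its two endpoints. $diam(T)$ is the diameter of $T$. Leader election in $T$: every node $v$ must output a finite sequence $P(v)=(p_1,\dots,p_k)$ of nonnegative integers (possibly empty). Let $P^*(v)$ be the path starting at $v$ obtained by taking $p_i$ as the outgoing port at the $i$-th node of the path. All $P^*(v)$ must be simple paths in $T$ ending at one common node (the leader). View: $V_T(v,r)$ is the subtree of $T$ induced by all nodes at distance at most $r$ from $v$, rooted at $v$, with all port numbers at these nodes and with the degrees of all nodes at distance exactly $r$ from $v$ (views are identified up to root- and port-preserving isomorphism). Deterministic algorithm with advice (LOCAL model): an oracle knowing $T$ assigns to $T$ one binary string $A(T)$, given to all nodes at the start; the size of advice for $T$ is the length of $A(T)$. After each round $r\ge 0$, each node $v$ that has not yet halted decides, as a function of $V_T(v,r)$ and $A(T)$ only, whether to halt and what to output. The algorithm works in time $\tau$ on $T$ if all nodes halt in rounds at most $\tau$. A tree is symmetric if it has a non-trivial port-preserving automorphism. $\xi(T)$ is the minimum time in which leader election in $T$ is feasible when each node is given the entire port-numbered map of $T$ (without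 its own position marked), i.e., the smallest $\tau$ for which there is a valid assignment of outputs in $T$ in which the output of each node $v$ depends only on $V_T(v,\tau)$. *)

theory Defs
  imports Complex_Main "HOL-Library.Extended_Nat"
begin

section \<open>Port-numbered trees\<close>

text \<open>
  \<open>port G u v\<close> is the port number at \<open>u\<close> of the edge \<open>{u, v}\<close>; its values on pairs that are
  not edges are irrelevant.
\<close>

record 'a pgraph =
  verts :: "'a set"
  edges :: "'a set set"
  port :: "'a \<Rightarrow> 'a \<Rightarrow> nat"

definition nbrs :: "('a, 'b) pgraph_scheme \<Rightarrow> 'a \<Rightarrow> 'a set" where
  "nbrs G v = {u \<in> verts G. {v, u} \<in> edges G}"

definition deg :: "('a, 'b) pgraph_scheme \<Rightarrow> 'a \<Rightarrow> nat" where
  "deg G v = card (nbrs G v)"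

definition walk :: "('a, 'b) pgraph_scheme \<Rightarrow> 'a list \<Rightarrow> bool" where
  "walk G xs \<longleftrightarrow> xs \<noteq> [] \<and> set xs \<subseteq> verts G \<and> successively (\<lambda>u v. {u, v} \<in> edges G) xs"

definition cycle :: "('a, 'b) pgraph_scheme \<Rightarrow> 'a list \<Rightarrow> bool" where
  "cycle G xs \<longleftrightarrow> walk G xs \<and> distinct xs \<and> length xs \<ge> 3 \<and> {last xs, hd xs} \<in> edges G"

definition ported_tree :: "('a, 'b) pgraph_scheme \<Rightarrow> bool" where
  "ported_tree T \<longleftrightarrow>
     finite (verts T) \<and> verts T \<noteq> {} \<and>
     (\<forall>e \<in> edges T. e \<subseteq> verts T \<and> card e = 2) \<and>
     (\<forall>u \<in> verts T. \<forall>v \<in> verts T. \<exists>xs. walk T xs \<and> hd xs = u \<and> last xs = v) \<and>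
     (\<nexists>xs. cycle T xs) \<and>
     (\<forall>v \<in> verts T. bij_betw (port T v) (nbrs T v) {..<deg T v})"

definition tdist :: "('a, 'b) pgraph_scheme \<Rightarrow> 'a \<Rightarrow> 'a \<Rightarrow> nat" where
  "tdist T u v = (LEAST n. \<exists>xs. walk T xs \<and> hd xs = u \<and> last xs = v \<and> length xs = Suc n)"

definition diam :: "('a, 'b) pgraph_scheme \<Rightarrow> nat" where
  "diam T = Max {tdist T u v | u v. u \<in> verts T \<and> v \<in> verts T}"

definition port_iso ::
  "('a \<Rightarrow> 'b) \<Rightarrow> ('a, 'c) pgraph_scheme \<Rightarrow> ('b, 'd) pgraph_scheme \<Rightarrow> bool" where
  "port_iso f G H \<longleftrightarrow>
     bij_betw f (verts G) (verts H) \<and>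
     (\<forall>u \<in> verts G. \<forall>v \<in> verts G. {u, v} \<in> edges G \<longleftrightarrow> {f u, f v} \<in> edges H) \<and>
     (\<forall>u \<in> verts G. \<forall>v \<in> verts G. {u, v} \<in> edges G \<longrightarrow> port H (f u) (f v) = port G u v)"

definition symmetric_tree :: "('a, 'b) pgraph_scheme \<Rightarrow> bool" where
  "symmetric_tree T \<longleftrightarrow> (\<exists>f. port_iso f T T \<and> (\<exists>v \<in> verts T. f v \<noteq> v))"


section \<open>Views\<close>

text \<open>
  A view is the subtree induced by a ball, with its root and with the degrees (in the whole tree)
  of the nodes at distance exactly \<open>r\<close> from the root. The values of \<open>port\<close> on non-edges and of
  \<open>bdeg\<close> outside \<open>verts\<close> are ignored by \<open>view_iso\<close>, so they carry no information to an algorithm.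
\<close>

record 'a view = "'a pgraph" +
  vroot :: 'a
  bdeg :: "'a \<Rightarrow> nat option"

definition view_of :: "'a pgraph \<Rightarrow> 'a \<Rightarrow> nat \<Rightarrow> 'a view" where
  "view_of T v r =
     (let B = {u \<in> verts T. tdist T v u \<le> r}
      in \<lparr>verts = B,
          edges = {e \<in> edges T. e \<subseteq> B},
          port = port T,
          vroot = v,
          bdeg = (\<lambda>u. if tdist T v u = r then Some (deg T u) else None)\<rparr>)"

definition view_iso :: "'a view \<Rightarrow> 'b view \<Rightarrow> bool" where
  "view_iso V W \<longleftrightarrow>
     (\<exists>f. port_iso f V W \<and> f (vroot V) = vroot W \<and> (\<forall>u \<in> verts V. bdeg W (f u) = bdeg V u))"


section \<open>Leader election\<close>

text \<open>\<open>xs\<close> is the node sequence obtained from \<open>v\<close> by following the outgoing ports \<open>ps\<close>.\<close>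

definition port_path :: "'a pgraph \<Rightarrow> 'a \<Rightarrow> nat list \<Rightarrow> 'a list \<Rightarrow> bool" where
  "port_path T v ps xs \<longleftrightarrow>
     walk T xs \<and> hd xs = v \<and> length xs = Suc (length ps) \<and>
     (\<forall>i < length ps. port T (xs ! i) (xs ! Suc i) = ps ! i)"

definition leader_election :: "'a pgraph \<Rightarrow> ('a \<Rightarrow> nat list) \<Rightarrow> bool" where
  "leader_election T P \<longleftrightarrow>
     (\<exists>l \<in> verts T. \<forall>v \<in> verts T. \<exists>xs. port_path T v (P v) xs \<and> distinct xs \<and> last xs = l)"

text \<open>With the map of \<open>T\<close> given, but not the own position, within time \<open>\<tau>\<close>.\<close>

definition election_feasible :: "'a pgraph \<Rightarrow> nat \<Rightarrow> bool" where
  "election_feasible T \<tau> \<longleftrightarrow>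
     (\<exists>P. leader_election T P \<and>
          (\<forall>u \<in> verts T. \<forall>v \<in> verts T.
             view_iso (view_of T u \<tau>) (view_of T v \<tau>) \<longrightarrow> P u = P v))"

text \<open>The value is \<open>\<infinity>\<close> if leader election is not feasible in any time.\<close>

definition xi :: "'a pgraph \<Rightarrow> enat" where
  "xi T = Inf {enat \<tau> | \<tau>. election_feasible T \<tau>}"


section \<open>Deterministic algorithms with advice\<close>

text \<open>
  An algorithm maps a view and the advice string to \<open>Some p\<close> (halt with output \<open>p\<close>) or to \<open>None\<close>
  (continue). Being a function of the view means respecting the identification of isomorphic
  views; likewise the oracle cannot distinguish isomorphic (anonymous) trees.
\<close>

type_synonym 'a algorithm = "'a view \<Rightarrow> bool list \<Rightarrow> nat list option"

definition anonymous_algorithm :: "'a algorithm \<Rightarrow> bool" where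
  "anonymous_algorithm alg \<longleftrightarrow>
     (\<forall>T T' v v' r r' a. ported_tree T \<and> ported_tree T' \<and> v \<in> verts T \<and> v' \<in> verts T' \<and>
        view_iso (view_of T v r) (view_of T' v' r') \<longrightarrow>
        alg (view_of T v r) a = alg (view_of T' v' r') a)"

definition anonymous_oracle :: "('a pgraph \<Rightarrow> bool list) \<Rightarrow> bool" where
  "anonymous_oracle A \<longleftrightarrow>
     (\<forall>T T' f. ported_tree T \<and> ported_tree T' \<and> port_iso f T T' \<longrightarrow> A T = A T')"

definition halting_round :: "'a algorithm \<Rightarrow> bool list \<Rightarrow> 'a pgraph \<Rightarrow> 'a \<Rightarrow> nat" where
  "halting_round alg a T v = (LEAST r. alg (view_of T v r) a \<noteq> None)"

definition elect_output :: "'a algorithm \<Rightarrow> bool list \<Rightarrow> 'a pgraph \<Rightarrow> 'a \<Rightarrow> nat list" where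
  "elect_output alg a T v = the (alg (view_of T v (halting_round alg a T v)) a)"

definition works_in_time :: "'a algorithm \<Rightarrow> bool list \<Rightarrow> 'a pgraph \<Rightarrow> nat \<Rightarrow> bool" where
  "works_in_time alg a T \<tau> \<longleftrightarrow>
     (\<forall>v \<in> verts T. \<exists>r \<le> \<tau>. alg (view_of T v r) a \<noteq> None)"

definition solves_election :: "'a algorithm \<Rightarrow> bool list \<Rightarrow> 'a pgraph \<Rightarrow> bool" where
  "solves_election alg a T \<longleftrightarrow> leader_election T (elect_output alg a T)"

end

theory Submission
  imports Defs
begin

text \<open>
  The advice is the binary code of the diameter. Nodes outside the ball of radius \<open>diam T - 1\<close>
  around \<open>v\<close> are leaves at distance exactly \<open>diam T\<close>; the degrees given at the boundary of the view
  determine their number and the ports leading to them, and their own port is \<open>0\<close>. So a node that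
  knows the diameter reconstructs the tree and its own position in it, up to isomorphism. As the
  tree is rigid, all nodes agree on the vertex corresponding to a vertex fixed in advance in a
  representative of the isomorphism class.
\<close>

section \<open>Simple paths in trees\<close>

definition tree_path :: "('a, 'b) pgraph_scheme \<Rightarrow> 'a \<Rightarrow> 'a \<Rightarrow> 'a list \<Rightarrow> bool" where
  "tree_path T u v xs \<longleftrightarrow> walk T xs \<and> distinct xs \<and> hd xs = u \<and> last xs = v"

lemma walk_append:
  "walk T (xs @ ys) \<longleftrightarrow>
     (if xs = [] then walk T ys else if ys = [] then walk T xs
      else walk T xs \<and> walk T ys \<and> {last xs, hd ys} \<in> edges T)"
  by (auto simp: walk_def successively_append_iff)

lemma walk_Cons:
  "walk T (x # ys) \<longleftrightarrow> x \<in> verts T \<and> (ys = [] \<or> walk T ys \<and> {x, hd ys} \<in> edges T)"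
  by (auto simp: walk_def successively_Cons)

lemma walk_rev: "walk T (rev xs) \<longleftrightarrow> walk T xs"
  by (simp add: walk_def insert_commute)

lemma walk_in_verts: "walk T xs \<Longrightarrow> x \<in> set xs \<Longrightarrow> x \<in> verts T"
  by (auto simp: walk_def)

text \<open>Follow the first path up to its first vertex \<open>z\<close> on the second one, then
  return to \<open>a\<close> along the second. By the choice of \<open>z\<close> the two pieces
  share only \<open>a\<close> and \<open>z\<close>, so the closed walk is simple.\<close>

lemma divergent_paths_cycle:
  assumes "walk T (a # xs)" "walk T (a # ys)" "distinct (a # xs)" "distinct (a # ys)"
    and "xs \<noteq> []" "ys \<noteq> []" "hd xs \<noteq> hd ys" "last xs = last ys"
  shows "\<exists>zs. cycle T zs"
proof -
  have "\<exists>z\<in>set xs. z \<in> set ys"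
    using assms(8) last_in_set[OF assms(5)] last_in_set[OF assms(6)] by (intro bexI[of _ "last xs"]) simp_all
  then obtain p z xs' where xs: "xs = p @ z # xs'" "z \<in> set ys" "\<forall>y\<in>set p. y \<notin> set ys"
    using split_list_first_prop[of xs "\<lambda>z. z \<in> set ys"] by auto
  then obtain q ys' where ys: "ys = q @ z # ys'"
    by (meson split_list)
  have "walk T ((a # p @ [z]) @ xs')" "walk T ((a # q @ [z]) @ ys')"
    using assms(1,2) xs ys by simp_all
  then have wx: "walk T ((a # p) @ [z])" and wy: "walk T (a # q @ [z])"
    unfolding walk_append[of T _ xs'] walk_append[of T _ ys'] by (simp_all split: if_splits)
  have "walk T (rev (a # q @ [z]))"
    using wy by (simp only: walk_rev)
  then have "walk T ((z # rev q) @ [a])" by simp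
  then have edge: "{last (z # rev q), a} \<in> edges T" and wz: "walk T (z # rev q)"
    unfolding walk_append by (simp_all split: if_splits)
  have "walk T ((a # p) @ (z # rev q))"
    using wx wz unfolding walk_append[of T "a # p"] by simp
  moreover have "distinct ((a # p) @ (z # rev q))"
    using assms(3,4) xs ys by auto
  \<comment> \<open>If both pieces were single edges, \<open>z\<close> would be the second vertex of
    both paths.\<close>
  moreover have "p \<noteq> [] \<or> q \<noteq> []"
    using assms(7) xs ys by auto
  then have "length ((a # p) @ (z # rev q)) \<ge> 3"
    by (cases p; cases q) auto
  ultimately have "cycle T ((a # p) @ (z # rev q))"
    using edge unfolding cycle_def by simp
  then show ?thesis ..
qed

text \<open>Induction by removing the common first vertex; paths that part right after it would
  close a cycle.\<close>

lemma tree_path_unique: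
  assumes "ported_tree T" "tree_path T u v xs" "tree_path T u v ys"
  shows "xs = ys"
  using assms(2,3)
proof (induction xs arbitrary: u ys)
  case Nil
  then show ?case by (simp add: tree_path_def walk_def)
next
  case (Cons a xs)
  then obtain ys' where ys: "ys = a # ys'"
    by (cases ys) (auto simp: tree_path_def walk_def)
  show ?case
  proof (cases "xs = [] \<or> ys' = []")
    \<comment> \<open>A one-vertex path means \<open>u = v\<close>, and distinctness then makes the
      other path trivial too.\<close>
    case True
    then show ?thesis
      using Cons.prems ys by (auto simp: tree_path_def split: if_splits)
  next
    case False
    have "hd xs = hd ys'"
    proof (rule ccontr)
      assume "hd xs \<noteq> hd ys'"
      then have "\<exists>zs. cycle T zs"
        using Cons.prems False unfolding ys tree_path_def
        by (intro divergent_paths_cycle[of T a xs ys']) auto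
      then show False
        using assms(1) by (auto simp: ported_tree_def)
    qed
    then have "tree_path T (hd xs) v xs" "tree_path T (hd xs) v ys'"
      using Cons.prems False unfolding ys tree_path_def by (auto simp: walk_Cons)
    then show ?thesis
      using Cons.IH ys by blast
  qed
qed

text \<open>A shortest walk is simple: cutting out the part between two visits to the same vertex
  leaves a shorter walk with the same ends.\<close>

lemma shortest_tree_path:
  assumes "ported_tree T" "u \<in> verts T" "v \<in> verts T"
  obtains xs where "tree_path T u v xs" "length xs = Suc (tdist T u v)"
proof -
  let ?P = "\<lambda>n. \<exists>xs. walk T xs \<and> hd xs = u \<and> last xs = v \<and> length xs = Suc n"
  obtain ys where "walk T ys" "hd ys = u" "last ys = v"
    using assms unfolding ported_tree_def by metis
  then have "?P (length ys - 1)"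
    by (intro exI[of _ ys]) (auto simp: walk_def)
  then have "?P (tdist T u v)"
    unfolding tdist_def by (rule LeastI)
  then obtain xs where xs: "walk T xs" "hd xs = u" "last xs = v" "length xs = Suc (tdist T u v)"
    by blast
  have "distinct xs"
  proof (rule ccontr)
    assume "\<not> distinct xs"
    then obtain a b c y where d: "xs = a @ [y] @ b @ [y] @ c"
      using not_distinct_decomp by blast
    let ?zs = "a @ [y] @ c"
    have "walk T ?zs"
      using xs(1) unfolding d by (auto simp: walk_append walk_Cons split: if_splits)
    moreover have "hd ?zs = u" "last ?zs = v"
      using xs(2,3) unfolding d by (auto simp: hd_append split: if_splits)
    ultimately have "?P (length ?zs - 1)"
      by (intro exI[of _ ?zs]) auto
    then have "tdist T u v \<le> length ?zs - 1"
      unfolding tdist_def by (rule Least_le)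
    then show False
      using xs(4) unfolding d by simp
  qed
  then show thesis
    using that xs by (auto simp: tree_path_def)
qed

text \<open>By uniqueness every simple path is the shortest one, so a distance can be read off any
  simple path at hand.\<close>

lemma tree_path_length:
  assumes "ported_tree T" "tree_path T u v xs"
  shows "length xs = Suc (tdist T u v)"
proof -
  have "u \<in> verts T" "v \<in> verts T"
    using assms(2) by (auto simp: tree_path_def walk_def)
  then show ?thesis
    using shortest_tree_path[OF assms(1)] tree_path_unique[OF assms] by metis
qed

lemma tree_path_appendD:
  "tree_path T u v (xs @ ys) \<Longrightarrow> xs \<noteq> [] \<Longrightarrow> tree_path T u (last xs) xs"
  by (auto simp: tree_path_def walk_append split: if_splits)

lemma tree_path_tdist_le:
  assumes "ported_tree T" "tree_path T u v xs" "x \<in> set xs"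
  shows "tdist T u x \<le> tdist T u v"
proof -
  obtain ys zs where xs: "xs = (ys @ [x]) @ zs"
    using assms(3) split_list by fastforce
  have "tree_path T u x (ys @ [x])"
    using tree_path_appendD[of T u v "ys @ [x]" zs] assms(2) by (simp add: xs)
  then show ?thesis
    using tree_path_length[OF assms(1,2)] tree_path_length[OF assms(1), of u x "ys @ [x]"]
    by (simp add: xs)
qed

text \<open>The prefix with \<open>Suc k\<close> vertices of the path from \<open>u\<close> to
  \<open>v\<close> is itself simple, so its last vertex is at distance \<open>k\<close>.\<close>

lemma tdist_intermediate:
  assumes "ported_tree T" "u \<in> verts T" "v \<in> verts T" "k \<le> tdist T u v"
  shows "\<exists>x\<in>verts T. tdist T u x = k"
proof -
  obtain xs where xs: "tree_path T u v xs" "length xs = Suc (tdist T u v)"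
    using shortest_tree_path assms by metis
  let ?ys = "take (Suc k) xs"
  have ys: "?ys \<noteq> []" "length ?ys = Suc k"
    using xs(2) assms(4) by auto
  have path: "tree_path T u (last ?ys) ?ys"
    using tree_path_appendD[of T u v ?ys "drop (Suc k) xs"] xs(1) ys(1) by simp
  then have "last ?ys \<in> verts T"
    using ys(1) walk_in_verts[of T ?ys "last ?ys"] last_in_set unfolding tree_path_def by blast
  moreover have "length ?ys = Suc (tdist T u (last ?ys))"
    using tree_path_length[OF assms(1) path] .
  ultimately show ?thesis
    using ys(2) by auto
qed

section \<open>Neighbours, the diameter and the farthest vertices\<close>

lemma edge_in_verts:
  "ported_tree T \<Longrightarrow> {u, v} \<in> edges T \<Longrightarrow> u \<in> verts T \<and> v \<in> verts T"
  by (auto simp: ported_tree_def)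

text \<open>The witness is the last but one vertex of the path from \<open>v\<close> to \<open>w\<close>.\<close>

lemma ex_parent:
  assumes T: "ported_tree T" and "v \<in> verts T" "w \<in> verts T" "w \<noteq> v"
  obtains p where "{p, w} \<in> edges T" "tdist T v w = Suc (tdist T v p)"
    "\<And>u. {u, w} \<in> edges T \<Longrightarrow> u = p \<or> tdist T v u = Suc (tdist T v w)"
proof -
  obtain xs where xs: "tree_path T v w xs"
    using shortest_tree_path assms by metis
  then have "xs \<noteq> []" "hd xs \<noteq> last xs" "last xs = w"
    using assms(4) by (auto simp: tree_path_def walk_def)
  then obtain q where q: "xs = q @ [w]" "q \<noteq> []"
    by (cases xs rule: rev_cases) force+
  have lq: "tree_path T v (last q) q"
    using tree_path_appendD[of T v w q "[w]"] xs q by auto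
  show thesis
  proof
    show "{last q, w} \<in> edges T"
      using xs q by (auto simp: tree_path_def walk_append)
    show "tdist T v w = Suc (tdist T v (last q))"
      using tree_path_length[OF T xs] tree_path_length[OF T lq] q by simp
    show "u = last q \<or> tdist T v u = Suc (tdist T v w)" if e: "{u, w} \<in> edges T" for u
    proof (cases "u \<in> set xs")
      case True
      have "u \<noteq> w"
        using e T by (auto simp: ported_tree_def)
      then have "u \<in> set q"
        using True q by auto
      then obtain a b where ab: "q = (a @ [u]) @ b"
        using split_list by fastforce
      have au: "tree_path T v u (a @ [u])"
        using tree_path_appendD[of T v "last q" "a @ [u]" b] lq ab by simp
      \<comment> \<open>Going straight from \<open>u\<close> to \<open>w\<close> is a second simple
        path; uniqueness forces \<open>u\<close> to be the last vertex of \<open>q\<close>.\<close>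
      have "tree_path T v w ((a @ [u]) @ [w])"
        using au xs e q ab edge_in_verts[OF T e]
        by (auto simp: tree_path_def walk_append walk_Cons hd_append split: if_splits)
      then have "xs = (a @ [u]) @ [w]"
        using tree_path_unique[OF T] xs by blast
      then show ?thesis
        using q by auto
    next
      case False
      \<comment> \<open>A neighbour off the path prolongs it by one vertex.\<close>
      have "tree_path T v u (xs @ [u])"
        using xs e False edge_in_verts[OF T e] \<open>xs \<noteq> []\<close>
        by (auto simp: tree_path_def walk_append walk_Cons hd_append insert_commute)
      from tree_path_length[OF T this] tree_path_length[OF T xs] show ?thesis
        by simp
    qed
  qed
qed

lemma tdist_self: "u \<in> verts T \<Longrightarrow> tdist T u u = 0"
  unfolding tdist_def by (rule Least_eq_0) (auto intro!: exI[of _ "[u]"] simp: walk_def)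

text \<open>Written as an image of a product, the set of distances is visibly finite and can be
  rewritten along an isomorphism.\<close>

lemma diam_eq: "diam T = Max ((\<lambda>(u, v). tdist T u v) ` (verts T \<times> verts T))"
  unfolding diam_def by (rule arg_cong[of _ _ Max]) auto

lemma tdist_le_diam:
  assumes "ported_tree T" "u \<in> verts T" "v \<in> verts T"
  shows "tdist T u v \<le> diam T"
  unfolding diam_eq using assms by (intro Max_ge) (auto simp: ported_tree_def)

text \<open>A vertex at distance \<open>diam T\<close> has no neighbour farther away, so its parent
  is its only neighbour; the single port of a vertex of degree one is \<open>0\<close>.\<close>

lemma far_vertex_leaf:
  assumes T: "ported_tree T" and v: "v \<in> verts T" and w: "w \<in> verts T"
    and far: "tdist T v w > diam T - 1"
  shows "\<exists>p. p \<in> verts T \<and> tdist T v p = diam T - 1 \<and>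
    (\<forall>u. {u, w} \<in> edges T \<longleftrightarrow> u = p) \<and> port T w p = 0"
proof -
  \<comment> \<open>If \<open>diam T = 0\<close>, truncated subtraction makes \<open>far\<close>
    contradict the bound by the diameter.\<close>
  have d: "tdist T v w = diam T"
    using far tdist_le_diam[OF T v w] by simp
  have "w \<noteq> v"
    using far tdist_self[OF v] by auto
  then obtain p where p: "{p, w} \<in> edges T" "tdist T v w = Suc (tdist T v p)"
    "\<And>u. {u, w} \<in> edges T \<Longrightarrow> u = p \<or> tdist T v u = Suc (tdist T v w)"
    using ex_parent[OF T v w] by metis
  have only: "{u, w} \<in> edges T \<longleftrightarrow> u = p" for u
    using p(1,3) d tdist_le_diam[OF T v] edge_in_verts[OF T] by (metis Suc_n_not_le_n)
  have pv: "p \<in> verts T"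
    using p(1) edge_in_verts[OF T] by blast
  have "nbrs T w = {p}"
    using only pv by (auto simp: nbrs_def insert_commute)
  then have "port T w p = 0"
    using T w by (auto simp: ported_tree_def deg_def bij_betw_def dest!: bspec[of _ _ w])
  then show ?thesis
    using pv only p(2) d by (intro exI[of _ p]) simp
qed


section \<open>Isomorphisms\<close>

lemma port_iso_inv:
  assumes "port_iso f G H"
  shows "port_iso (inv_into (verts G) f) H G"
proof -
  let ?g = "inv_into (verts G) f"
  have f: "bij_betw f (verts G) (verts H)"
    using assms by (simp add: port_iso_def)
  then have g: "bij_betw ?g (verts H) (verts G)"
    by (rule bij_betw_inv_into)
  have fg: "f (?g u) = u" "?g u \<in> verts G" if "u \<in> verts H" for u
    using that f g by (auto simp: bij_betw_inv_into_right bij_betwE)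
  show ?thesis
    using assms g fg unfolding port_iso_def by metis
qed

lemma port_iso_comp:
  assumes "port_iso f G H" "port_iso g H K"
  shows "port_iso (g \<circ> f) G K"
proof -
  have "f u \<in> verts H" if "u \<in> verts G" for u
    using assms(1) that by (auto simp: port_iso_def bij_betwE)
  then show ?thesis
    using assms by (auto simp: port_iso_def bij_betw_trans)
qed

lemma view_iso_sym:
  assumes "view_iso V W" "vroot V \<in> verts V"
  shows "view_iso W V"
proof -
  obtain f where f: "port_iso f V W" "f (vroot V) = vroot W" "\<forall>u\<in>verts V. bdeg W (f u) = bdeg V u"
    using assms by (auto simp: view_iso_def)
  have b: "bij_betw f (verts V) (verts W)"
    using f(1) by (simp add: port_iso_def)
  \<comment> \<open>\<open>inv_into\<close> undoes \<open>f\<close> only on \<open>verts V\<close>,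
    hence the assumption on the root.\<close>
  have "inv_into (verts V) f (vroot W) = vroot V"
    using bij_betw_inv_into_left[OF b assms(2)] f(2) by simp
  moreover have "bdeg V (inv_into (verts V) f u) = bdeg W u" if "u \<in> verts W" for u
    using bij_betw_inv_into_right[OF b that] bij_betw_apply[OF bij_betw_inv_into[OF b] that] f(3)
    by force
  ultimately show ?thesis
    using port_iso_inv[OF f(1)] unfolding view_iso_def by blast
qed

lemma view_iso_trans:
  assumes "view_iso U V" "view_iso V W"
  shows "view_iso U W"
proof -
  obtain f where f: "port_iso f U V" "f (vroot U) = vroot V" "\<forall>u\<in>verts U. bdeg V (f u) = bdeg U u"
    using assms by (auto simp: view_iso_def)
  obtain g where g: "port_iso g V W" "g (vroot V) = vroot W" "\<forall>u\<in>verts V. bdeg W (g u) = bdeg V u"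
    using assms by (auto simp: view_iso_def)
  have "f u \<in> verts V" if "u \<in> verts U" for u
    using f(1) that by (auto simp: port_iso_def bij_betwE)
  then show ?thesis
    using port_iso_comp[OF f(1) g(1)] f(2,3) g(2,3) unfolding view_iso_def
    by (intro exI[of _ "g \<circ> f"]) simp
qed

section \<open>Paths, distances and degrees under isomorphisms\<close>

lemma port_iso_walk:
  assumes "port_iso f G H" "walk G xs"
  shows "walk H (map f xs)"
proof -
  have "successively (\<lambda>u v. {f u, f v} \<in> edges H) xs"
    using assms unfolding walk_def port_iso_def
    by (elim conjE, elim successively_mono) (auto simp: subset_iff)
  then show ?thesis
    using assms unfolding walk_def port_iso_def
    by (auto simp: successively_map bij_betwE)
qed

lemma port_iso_tree_path:
  assumes "port_iso f G H" "tree_path G u v xs"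
  shows "tree_path H (f u) (f v) (map f xs)"
proof -
  have "inj_on f (verts G)" "set xs \<subseteq> verts G" "xs \<noteq> []"
    using assms by (auto simp: port_iso_def bij_betw_def tree_path_def walk_def)
  then show ?thesis
    using assms port_iso_walk[of f G H xs]
    by (auto simp: tree_path_def distinct_map hd_map last_map intro: inj_on_subset)
qed

text \<open>The image of a simple path is a simple path with as many vertices, and the length of any
  simple path determines the distance.\<close>

lemma port_iso_tdist:
  assumes "ported_tree T" "ported_tree T'" "port_iso f T T'" "u \<in> verts T" "v \<in> verts T"
  shows "tdist T' (f u) (f v) = tdist T u v"
proof -
  obtain xs where xs: "tree_path T u v xs" "length xs = Suc (tdist T u v)"
    using shortest_tree_path assms by metis
  then show ?thesis
    using tree_path_length[OF assms(2) port_iso_tree_path[OF assms(3) xs(1)]] by simp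
qed

lemma port_iso_diam:
  assumes "ported_tree T" "ported_tree T'" "port_iso f T T'"
  shows "diam T' = diam T"
proof -
  have f: "f ` verts T = verts T'"
    using assms(3) by (auto simp: port_iso_def bij_betw_def)
  have "(\<lambda>(u, v). tdist T' u v) ` (verts T' \<times> verts T')
      = (\<lambda>(u, v). tdist T' (f u) (f v)) ` (verts T \<times> verts T)"
    unfolding f[symmetric] by force
  also have "\<dots> = (\<lambda>(u, v). tdist T u v) ` (verts T \<times> verts T)"
    using port_iso_tdist[OF assms] by (intro image_cong) auto
  finally show ?thesis
    by (simp add: diam_eq)
qed

lemma port_iso_deg:
  assumes "port_iso f T T'" "v \<in> verts T"
  shows "deg T' (f v) = deg T v"
proof -
  have f: "inj_on f (verts T)" "f ` verts T = verts T'"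
    using assms(1) by (auto simp: port_iso_def bij_betw_def)
  have "nbrs T' (f v) = f ` nbrs T v"
    using assms unfolding nbrs_def port_iso_def f(2)[symmetric] by auto
  moreover have "inj_on f (nbrs T v)"
    using f(1) by (auto simp: nbrs_def intro: inj_on_subset)
  ultimately show ?thesis
    by (simp add: deg_def card_image)
qed

section \<open>Views and isomorphisms of whole trees\<close>

lemma view_of_simps [simp]:
  "verts (view_of T v r) = {u \<in> verts T. tdist T v u \<le> r}"
  "edges (view_of T v r) = {e \<in> edges T. e \<subseteq> {u \<in> verts T. tdist T v u \<le> r}}"
  "port (view_of T v r) = port T"
  "vroot (view_of T v r) = v"
  "bdeg (view_of T v r) u = (if tdist T v u = r then Some (deg T u) else None)"
  by (simp_all add: view_of_def Let_def)

lemma port_iso_view_iso: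
  assumes "ported_tree T" "ported_tree T'" "port_iso f T T'" "v \<in> verts T"
  shows "view_iso (view_of T v r) (view_of T' (f v) r)"
proof -
  let ?B = "{u \<in> verts T. tdist T v u \<le> r}" and ?B' = "{u \<in> verts T'. tdist T' (f v) u \<le> r}"
  have f: "inj_on f (verts T)" "f ` verts T = verts T'"
    using assms(3) by (auto simp: port_iso_def bij_betw_def)
  have d: "tdist T' (f v) (f u) = tdist T v u" if "u \<in> verts T" for u
    using port_iso_tdist[OF assms(1-4) that] .
  have "f ` ?B = ?B'"
    unfolding f(2)[symmetric] using d by auto
  moreover have "inj_on f ?B"
    using f(1) by (rule inj_on_subset) auto
  ultimately have "bij_betw f ?B ?B'"
    by (simp add: bij_betw_def)
  then have "port_iso f (view_of T v r) (view_of T' (f v) r)"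
    using assms(3) d f(2) unfolding port_iso_def by auto
  then show ?thesis
    using d port_iso_deg[OF assms(3)] unfolding view_iso_def by (intro exI[of _ f]) auto
qed


section \<open>Reconstruction of the tree\<close>

text \<open>The path from the root to \<open>u\<close> never leaves the ball, so \<open>f\<close>
  carries it to a simple path of \<open>T'\<close>. The radii may differ, which allows views from
  different rounds to be compared.\<close>

lemma view_iso_tdist:
  assumes T: "ported_tree T" "ported_tree T'" and v: "v \<in> verts T"
    and f: "port_iso f (view_of T v r) (view_of T' v' r')" "f v = v'"
    and u: "u \<in> verts T" "tdist T v u \<le> r"
  shows "tdist T' v' (f u) = tdist T v u"
proof -
  obtain xs where xs: "tree_path T v u xs" "length xs = Suc (tdist T v u)"
    using shortest_tree_path T v u by metis
  have B: "set xs \<subseteq> {x \<in> verts T. tdist T v x \<le> r}"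
    using xs tree_path_tdist_le[OF T(1) xs(1)] u(2)
    by (fastforce simp: tree_path_def walk_def)
  have "successively (\<lambda>x y. {x, y} \<in> edges (view_of T v r)) xs"
    using xs(1) B unfolding tree_path_def walk_def
    by (elim conjE, elim successively_mono) auto
  then have "tree_path (view_of T v r) v u xs"
    using xs(1) B by (auto simp: tree_path_def walk_def)
  then have "tree_path (view_of T' v' r') v' (f u) (map f xs)"
    using port_iso_tree_path[OF f(1)] f(2) by metis
  then have "tree_path T' v' (f u) (map f xs)"
    by (auto simp: tree_path_def walk_def elim!: successively_mono)
  then show ?thesis
    using tree_path_length[OF T(2)] xs(2) by fastforce
qed

section \<open>Port numbers at a vertex\<close>

lemma port_bij:
  "ported_tree T \<Longrightarrow> v \<in> verts T \<Longrightarrow> bij_betw (port T v) (nbrs T v) {..<deg T v}"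
  by (simp add: ported_tree_def)

lemma port_inj:
  assumes "ported_tree T" "{u, x} \<in> edges T" "{u, y} \<in> edges T" "port T u x = port T u y"
  shows "x = y"
proof -
  have "u \<in> verts T" "x \<in> nbrs T u" "y \<in> nbrs T u"
    using edge_in_verts[OF assms(1)] assms(2,3) by (auto simp: nbrs_def)
  then show ?thesis
    using port_bij[OF assms(1)] assms(4) by (auto simp: bij_betw_def inj_on_def)
qed

lemma port_less_deg:
  assumes "ported_tree T" "{u, x} \<in> edges T"
  shows "port T u x < deg T u"
proof -
  have "u \<in> verts T" "x \<in> nbrs T u"
    using edge_in_verts[OF assms] assms(2) by (auto simp: nbrs_def)
  then show ?thesis
    using bij_betw_apply[OF port_bij[OF assms(1)]] by blast
qed

lemma port_surj:
  assumes "ported_tree T" "u \<in> verts T" "p < deg T u"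
  obtains x where "{u, x} \<in> edges T" "port T u x = p"
proof -
  have "p \<in> port T u ` nbrs T u"
    using port_bij[OF assms(1,2)] assms(3) by (auto simp: bij_betw_def)
  then show thesis
    using that by (auto simp: nbrs_def)
qed

text \<open>Nodes outside the view are leaves; each is located by the port leading to it from its
  neighbour, which lies on the boundary of the view and hence has a known degree.\<close>

lemma view_iso_extend:
  assumes T: "ported_tree T" and T': "ported_tree T'" and D: "diam T' = diam T"
    and v: "v \<in> verts T" and v': "v' \<in> verts T'"
    and iso: "view_iso (view_of T v (diam T - 1)) (view_of T' v' (diam T - 1))"
  obtains g where "port_iso g T T'" "g v = v'"
proof -
  define r where "r = diam T - 1"
  define B where "B = {u \<in> verts T. tdist T v u \<le> r}"
  define B' where "B' = {u \<in> verts T'. tdist T' v' u \<le> r}"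
  obtain f where f: "port_iso f (view_of T v r) (view_of T' v' r)" "f v = v'"
    and fdeg: "\<And>u. u \<in> B \<Longrightarrow> bdeg (view_of T' v' r) (f u) = bdeg (view_of T v r) u"
    using iso unfolding view_iso_def r_def B_def by auto
  have vB: "v \<in> B"
    using v tdist_self[OF v] by (simp add: B_def)
  have fB: "bij_betw f B B'"
    using f(1) by (simp add: port_iso_def B_def B'_def)
  have fin: "f u \<in> B'" if "u \<in> B" for u
    using fB that by (rule bij_betw_apply)
  have view: "verts (view_of T v r) = B" "verts (view_of T' v' r) = B'"
    "\<And>x y. {x, y} \<in> edges (view_of T v r) \<longleftrightarrow> {x, y} \<in> edges T \<and> x \<in> B \<and> y \<in> B"
    "\<And>x y. {x, y} \<in> edges (view_of T' v' r) \<longleftrightarrow> {x, y} \<in> edges T' \<and> x \<in> B' \<and> y \<in> B'"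
    by (auto simp: B_def B'_def)
  have fedge: "{f x, f y} \<in> edges T' \<longleftrightarrow> {x, y} \<in> edges T" if "x \<in> B" "y \<in> B" for x y
    using f(1) that fin[OF that(1)] fin[OF that(2)] unfolding port_iso_def view by simp
  have fport: "port T' (f x) (f y) = port T x y" if "x \<in> B" "y \<in> B" "{x, y} \<in> edges T" for x y
    using f(1) that unfolding port_iso_def view by simp
  have fdist: "tdist T' v' (f u) = tdist T v u" if "u \<in> B" for u
    using view_iso_tdist[OF T T' v f] that by (simp add: B_def)
  \<comment> \<open>As \<open>f\<close> preserves the distance to the root, both boundary labels are
    \<open>Some\<close> here.\<close>
  have fdeg': "deg T' (f u) = deg T u" if "u \<in> B" "tdist T v u = r" for u
    using fdeg[OF that(1)] fdist[OF that(1)] that(2) by simp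
  have finj: "x = y" if "x \<in> B" "y \<in> B" "f x = f y" for x y
    using fB that by (auto simp: bij_betw_def inj_on_def)

  have "\<exists>p. p \<in> B \<and> tdist T v p = r \<and> (\<forall>u. {u, w} \<in> edges T \<longleftrightarrow> u = p) \<and> port T w p = 0"
    if "w \<in> verts T - B" for w
    using that far_vertex_leaf[OF T v, of w] by (fastforce simp: B_def r_def)
  then obtain par where par: "par w \<in> B" "tdist T v (par w) = r"
      "{u, w} \<in> edges T \<longleftrightarrow> u = par w" "port T w (par w) = 0" if "w \<in> verts T - B" for w u
    by metis
  have "\<exists>p. p \<in> B' \<and> tdist T' v' p = r \<and> (\<forall>u. {u, w} \<in> edges T' \<longleftrightarrow> u = p) \<and> port T' w p = 0"
    if "w \<in> verts T' - B'" for w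
    using that far_vertex_leaf[OF T' v', of w] by (fastforce simp: B'_def r_def D)
  then obtain par' where par': "par' w \<in> B'" "tdist T' v' (par' w) = r"
      "{u, w} \<in> edges T' \<longleftrightarrow> u = par' w" "port T' w (par' w) = 0" if "w \<in> verts T' - B'" for w u
    by metis

  \<comment> \<open>The image of \<open>w\<close> is found behind the same port at
    \<open>f (par w)\<close>. That port exists since the degrees agree, and it leads out of
    \<open>B'\<close>, because inside \<open>B\<close> it would belong to a vertex other than
    \<open>w\<close>.\<close>
  have "\<exists>q. q \<in> verts T' - B' \<and> {f (par w), q} \<in> edges T' \<and> port T' (f (par w)) q = port T (par w) w"
    if w: "w \<in> verts T - B" for w
  proof -
    have e: "{par w, w} \<in> edges T"
      using par(3)[OF w] by simp
    have "port T (par w) w < deg T' (f (par w))"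
      using port_less_deg[OF T e] fdeg' par(1,2) w by simp
    moreover have "f (par w) \<in> verts T'"
      using fin par(1) w by (auto simp: B'_def)
    ultimately obtain q where q: "{f (par w), q} \<in> edges T'" "port T' (f (par w)) q = port T (par w) w"
      using port_surj[OF T'] by metis
    have "q \<notin> B'"
    proof
      assume "q \<in> B'"
      then obtain x where x: "x \<in> B" "q = f x"
        using fB by (auto simp: bij_betw_def)
      then have "{par w, x} \<in> edges T"
        using fedge q(1) par(1) w by simp
      then have "x = w"
        using port_inj[OF T _ e] fport q(2) x par(1) w by metis
      then show False
        using x w by simp
    qed
    then show ?thesis
      using q edge_in_verts[OF T'] by blast
  qed
  then obtain h where h: "h w \<in> verts T' - B'" "{f (par w), h w} \<in> edges T'"
      "port T' (f (par w)) (h w) = port T (par w) w" if "w \<in> verts T - B" for w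
    by metis
  have par_h: "par' (h w) = f (par w)" if "w \<in> verts T - B" for w
    using par'(3)[OF h(1)[OF that]] h(2)[OF that] by simp

  \<comment> \<open>\<open>h x\<close> determines the parent of \<open>x\<close> and the port from
    there to \<open>x\<close>.\<close>
  have "inj_on h (verts T - B)"
  proof (rule inj_onI)
    fix x y assume xy: "x \<in> verts T - B" "y \<in> verts T - B" "h x = h y"
    then have "f (par x) = f (par y)"
      using par_h by metis
    then have "par x = par y"
      using finj par(1) xy by blast
    then show "x = y"
      using port_inj[OF T, of "par x" x y] par(3)[OF xy(1)] par(3)[OF xy(2)]
        h(3)[OF xy(1)] h(3)[OF xy(2)] xy(3) by simp
  qed
  moreover have "h ` (verts T - B) = verts T' - B'"
  proof
    show "h ` (verts T - B) \<subseteq> verts T' - B'"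
      using h(1) by blast
    show "verts T' - B' \<subseteq> h ` (verts T - B)"
    proof
      \<comment> \<open>The construction of \<open>h\<close> in reverse: \<open>w\<close> lies
        behind the port at \<open>u\<close> that leads from \<open>f u\<close> to
        \<open>z\<close>.\<close>
      fix z assume z: "z \<in> verts T' - B'"
      obtain u where u: "u \<in> B" "par' z = f u"
        using par'(1)[OF z] fB by (auto simp: bij_betw_def)
      have e: "{f u, z} \<in> edges T'"
        using par'(3)[OF z] u(2) by simp
      have "tdist T v u = r"
        using fdist[OF u(1)] par'(2)[OF z] u(2) by simp
      then have "port T' (f u) z < deg T u"
        using port_less_deg[OF T' e] fdeg' u(1) by simp
      then obtain w where w: "{u, w} \<in> edges T" "port T u w = port T' (f u) z"
        using port_surj[OF T, of u] u(1) by (auto simp: B_def)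
      have "w \<notin> B"
      proof
        assume "w \<in> B"
        then have "f w = z"
          using port_inj[OF T' _ e] fedge fport u(1) w by metis
        then show False
          using z fin \<open>w \<in> B\<close> by blast
      qed
      then have wB: "w \<in> verts T - B"
        using w(1) edge_in_verts[OF T] by blast
      then have "par w = u"
        using par(3)[OF wB] w(1) by simp
      then have "h w = z"
        using port_inj[OF T' _ e] h(2,3)[OF wB] w(2) by metis
      then show "z \<in> h ` (verts T - B)"
        using wB by blast
    qed
  qed
  ultimately have hbij: "bij_betw h (verts T - B) (verts T' - B')"
    by (simp add: bij_betw_def)

  define g where "g x = (if x \<in> B then f x else h x)" for x
  have "bij_betw g B B'" "bij_betw g (verts T - B) (verts T' - B')"
    using fB hbij bij_betw_cong[of B g f] bij_betw_cong[of "verts T - B" g h]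
    by (simp_all add: g_def)
  then have "bij_betw g (B \<union> (verts T - B)) (B' \<union> (verts T' - B'))"
    by (rule bij_betw_combine) auto
  moreover have "B \<union> (verts T - B) = verts T" "B' \<union> (verts T' - B') = verts T'"
    by (auto simp: B_def B'_def)
  ultimately have "bij_betw g (verts T) (verts T')"
    by simp
  \<comment> \<open>Both directions of the port condition are included, so that a pair whose first
    vertex lies outside \<open>B\<close> follows by swapping.\<close>
  moreover have out: "({x, y} \<in> edges T \<longleftrightarrow> {g x, g y} \<in> edges T') \<and>
      ({x, y} \<in> edges T \<longrightarrow> port T' (g x) (g y) = port T x y \<and> port T' (g y) (g x) = port T y x)"
    if x: "x \<in> verts T" and y: "y \<in> verts T - B" for x y
  proof (cases "x \<in> B")
    case True
    have "{g x, g y} \<in> edges T' \<longleftrightarrow> f x = f (par y)"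
      using par'(3)[OF h(1)[OF y]] par_h[OF y] True y by (simp add: g_def)
    then have "{x, y} \<in> edges T \<longleftrightarrow> {g x, g y} \<in> edges T'"
      using par(3)[OF y] par(1)[OF y] finj True by metis
    moreover have "port T' (g x) (g y) = port T x y \<and> port T' (g y) (g x) = port T y x"
      if "{x, y} \<in> edges T"
      using that True y par(3,4)[OF y] par'(4)[OF h(1)[OF y]] par_h[OF y] h(3)[OF y]
      by (simp add: g_def)
    ultimately show ?thesis by blast
  next
    case False
    \<comment> \<open>Two vertices outside the ball are never adjacent, since the only neighbour of
      each is its parent inside; the same holds in \<open>T'\<close>.\<close>
    then have "{x, y} \<notin> edges T"
      using par(3)[OF y] par(1)[OF y] by metis
    moreover have "h x \<noteq> par' (h y)"
      using h(1)[of x] x False par'(1)[OF h(1)[OF y]] by auto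
    then have "{g x, g y} \<notin> edges T'"
      using par'(3)[OF h(1)[OF y]] False y by (simp add: g_def)
    ultimately show ?thesis by blast
  qed
  have "({x, y} \<in> edges T \<longleftrightarrow> {g x, g y} \<in> edges T') \<and>
      ({x, y} \<in> edges T \<longrightarrow> port T' (g x) (g y) = port T x y)"
    if "x \<in> verts T" "y \<in> verts T" for x y
  proof (cases "x \<in> B \<and> y \<in> B")
    case True
    then show ?thesis
      using fedge fport by (simp add: g_def)
  next
    case False
    then show ?thesis
      using out[of x y] out[of y x] that by (metis DiffI insert_commute)
  qed
  ultimately have "port_iso g T T'"
    by (simp add: port_iso_def)
  moreover have "g v = v'"
    using vB f(2) by (simp add: g_def)
  ultimately show thesis
    using that by blast
qed

text \<open>A path to a vertex beyond radius \<open>r\<close> would pass through distance exactly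
  \<open>r\<close>. Thus a view with empty boundary shows the whole tree.\<close>

lemma view_of_covers:
  assumes "ported_tree T" "v \<in> verts T" "\<And>u. u \<in> verts T \<Longrightarrow> tdist T v u \<le> r \<Longrightarrow> tdist T v u \<noteq> r"
    and "u \<in> verts T"
  shows "tdist T v u \<le> r"
proof (rule ccontr)
  assume "\<not> tdist T v u \<le> r"
  then obtain x where "x \<in> verts T" "tdist T v x = r"
    using tdist_intermediate[OF assms(1,2,4), of r] by auto
  then show False
    using assms(3)[of x] by simp
qed

text \<open>In an early round \<open>r < diam T - 1\<close>, a view isomorphic to one of radius \<open>diam T - 1\<close> has no
  boundary, hence is the whole tree.\<close>

lemma view_iso_rooted_port_iso:
  assumes T: "ported_tree T" and T': "ported_tree T'" and D: "diam T' = diam T"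
    and v: "v \<in> verts T" and v': "v' \<in> verts T'" and r: "r \<le> diam T - 1"
    and iso: "view_iso (view_of T v r) (view_of T' v' (diam T - 1))"
  obtains g where "port_iso g T T'" "g v = v'"
proof (cases "r = diam T - 1")
  case True
  then show thesis
    using view_iso_extend[OF T T' D v v'] iso that by blast
next
  case False
  define r' where "r' = diam T - 1"
  define B where "B = {u \<in> verts T. tdist T v u \<le> r}"
  define B' where "B' = {u \<in> verts T'. tdist T' v' u \<le> r'}"
  have verts: "verts (view_of T v r) = B" "verts (view_of T' v' r') = B'"
    by (simp_all add: B_def B'_def)
  obtain f where f: "port_iso f (view_of T v r) (view_of T' v' r')" "f v = v'"
    and fdeg: "\<forall>u\<in>B. bdeg (view_of T' v' r') (f u) = bdeg (view_of T v r) u"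
    using iso unfolding view_iso_def verts r'_def[symmetric] by (simp only: view_of_simps) blast
  have fB: "f ` B = B'"
    using f(1) by (simp add: port_iso_def bij_betw_def verts del: view_of_simps)
  have fdist: "tdist T' v' (f u) = tdist T v u" if "u \<in> B" for u
    using view_iso_tdist[OF T T' v f] that by (simp add: B_def)
  \<comment> \<open>A boundary label on one side requires one on the other, and \<open>f\<close>
    preserves distances; one distance would then equal both \<open>r\<close> and
    \<open>r'\<close>.\<close>
  have bd: "tdist T v u \<noteq> r \<and> tdist T v u \<noteq> r'" if "u \<in> B" for u
  proof -
    have "r \<noteq> r'"
      using False by (simp add: r'_def)
    then show ?thesis
      using bspec[OF fdeg that] fdist[OF that] by (simp split: if_splits)
  qed
  have "tdist T v u \<le> r" if "u \<in> verts T" for u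
    using view_of_covers[OF T v _ that] bd by (simp add: B_def)
  then have BT: "B = verts T"
    by (auto simp: B_def)
  have "tdist T' v' u \<noteq> r'" if "u \<in> B'" for u
    using that bd fdist unfolding fB[symmetric] by force
  then have "tdist T' v' u \<le> r'" if "u \<in> verts T'" for u
    using view_of_covers[OF T' v' _ that] by (simp add: B'_def)
  then have BT': "B' = verts T'"
    by (auto simp: B'_def)
  have "{x, y} \<in> edges (view_of T v r) \<longleftrightarrow> {x, y} \<in> edges T" if "x \<in> B" "y \<in> B" for x y
    using that by (simp add: B_def)
  moreover have "{x, y} \<in> edges (view_of T' v' r') \<longleftrightarrow> {x, y} \<in> edges T'" if "x \<in> B'" "y \<in> B'" for x y
    using that by (simp add: B'_def)
  moreover have "port (view_of T v r) = port T" "port (view_of T' v' r') = port T'"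
    by simp_all
  moreover have "f x \<in> B'" if "x \<in> B" for x
    using fB that by blast
  ultimately have "port_iso f T T'"
    using f(1) unfolding port_iso_def verts BT[symmetric] BT'[symmetric] by simp
  then show thesis
    using that f(2) by blast
qed


section \<open>The algorithm\<close>

fun binary :: "nat \<Rightarrow> bool list" where
  "binary n = (if n = 0 then [] else odd n # binary (n div 2))"

declare binary.simps [simp del]

lemma binary_inj: "binary m = binary n \<Longrightarrow> m = n"
proof (induction m arbitrary: n rule: binary.induct)
  case (1 m)
  show ?case
  proof (cases "m = 0 \<or> n = 0")
    case True
    then show ?thesis
      using "1.prems" by (auto simp: binary.simps[of m] binary.simps[of n] split: if_splits)
  next
    case False
    then have "odd m = odd n" "binary (m div 2) = binary (n div 2)"
      using "1.prems" by (auto simp: binary.simps[of m] binary.simps[of n])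
    then have "m mod 2 = n mod 2" "m div 2 = n div 2"
      using "1.IH" False by (auto simp: odd_iff_mod_2_eq_one even_iff_mod_2_eq_zero)
    then show ?thesis
      by (metis div_mult_mod_eq)
  qed
qed

text \<open>In this multiplicative form the induction is immediate: one more digit doubles the left
  side, and \<open>2 * (n div 2)\<close> is at most \<open>n\<close>.\<close>

lemma length_binary:
  assumes "0 < n"
  shows "2 ^ length (binary n) \<le> 2 * n"
  using assms
proof (induction n rule: binary.induct)
  case (1 n)
  show ?case
  proof (cases "n div 2 = 0")
    case True
    then show ?thesis
      using 1 by (simp add: binary.simps)
  next
    case False
    then show ?thesis
      using 1 by (simp add: binary.simps[of n])
  qed
qed

lemma length_binary_le_log:
  assumes "n \<le> D" "2 \<le> D"
  shows "real (length (binary n)) \<le> 2 * log 2 (real D)"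
proof (cases "n = 0")
  case True
  then show ?thesis
    using assms by (simp add: binary.simps)
next
  case False
  \<comment> \<open>Bounding the factor 2 by \<open>D\<close> turns \<open>2 * n\<close> into
    \<open>D * D\<close>, which yields the constant 2 in front of the logarithm.\<close>
  have "2 ^ length (binary n) \<le> D * D"
    using length_binary[of n] False mult_le_mono[OF assms(2,1)] by linarith
  then have "(2::real) ^ length (binary n) \<le> real D ^ 2"
    by (metis of_nat_le_iff of_nat_mult of_nat_numeral of_nat_power power2_eq_square)
  then have "real (length (binary n)) \<le> log 2 (real D ^ 2)"
    by (rule le_log_of_power) simp
  then show ?thesis
    using assms(2) by (simp add: log_nat_power)
qed

text \<open>The port sequence itself is unchanged, so an output computed in a representative is
  valid at the corresponding vertex of the actual tree.\<close>

lemma port_path_iso: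
  assumes "port_iso f T T'" "port_path T v ps xs"
  shows "port_path T' (f v) ps (map f xs)"
proof -
  have "port T' (f (xs ! i)) (f (xs ! Suc i)) = ps ! i" if "i < length ps" for i
  proof -
    have w: "walk T xs" "Suc i < length xs"
      using assms(2) that by (auto simp: port_path_def)
    then have "{xs ! i, xs ! Suc i} \<in> edges T" "xs ! i \<in> verts T" "xs ! Suc i \<in> verts T"
      using successively_nth[of _ xs i] by (auto simp: walk_def)
    then show ?thesis
      using assms that by (simp add: port_iso_def port_path_def)
  qed
  then show ?thesis
    using assms port_iso_walk[of f T T' xs] unfolding port_path_def
    by (auto simp: hd_map walk_def)
qed

lemma ex_port_path:
  assumes "ported_tree T" "v \<in> verts T" "l \<in> verts T"
  shows "\<exists>ps xs. port_path T v ps xs \<and> distinct xs \<and> last xs = l"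
proof -
  obtain xs where xs: "tree_path T v l xs"
    using shortest_tree_path assms by metis
  let ?ps = "map (\<lambda>i. port T (xs ! i) (xs ! Suc i)) [0..<length xs - 1]"
  have "port_path T v ?ps xs"
    using xs by (auto simp: port_path_def tree_path_def walk_def)
  then show ?thesis
    using xs by (auto simp: tree_path_def)
qed

section \<open>The election algorithm\<close>

text \<open>A canonical member of the isomorphism class: isomorphic trees get equal, not just
  isomorphic, representatives.\<close>

definition tree_rep :: "'a pgraph \<Rightarrow> 'a pgraph" where
  "tree_rep T = (SOME R. ported_tree R \<and> (\<exists>f. port_iso f T R))"

text \<open>The leader is chosen from \<open>R\<close> alone, independently of \<open>w\<close>;
  this is what makes all nodes agree.\<close>

definition path_to_leader :: "'a pgraph \<Rightarrow> 'a \<Rightarrow> nat list" where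
  "path_to_leader R w = (SOME ps. \<exists>xs. port_path R w ps xs \<and> distinct xs \<and>
     last xs = (SOME l. l \<in> verts R))"

definition candidates :: "'a view \<Rightarrow> bool list \<Rightarrow> ('a pgraph \<times> 'a) set" where
  "candidates V a = {(R, w). ported_tree R \<and> tree_rep R = R \<and> w \<in> verts R \<and>
     binary (diam R) = a \<and> view_iso V (view_of R w (diam R - 1))}"

definition elect :: "'a algorithm" where
  "elect V a = (if candidates V a = {} then None
     else Some (case_prod path_to_leader (SOME c. c \<in> candidates V a)))"

lemma port_iso_id: "port_iso id T T"
  by (simp add: port_iso_def)

lemma tree_rep_iso:
  assumes "ported_tree T"
  shows "ported_tree (tree_rep T)" "\<exists>f. port_iso f T (tree_rep T)"
proof -
  have "\<exists>R :: 'a pgraph. ported_tree R \<and> (\<exists>f. port_iso f T R)"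
    using assms port_iso_id[of T] by blast
  then have "ported_tree (tree_rep T) \<and> (\<exists>f. port_iso f T (tree_rep T))"
    unfolding tree_rep_def by (rule someI_ex)
  then show "ported_tree (tree_rep T)" "\<exists>f. port_iso f T (tree_rep T)"
    by simp_all
qed

text \<open>Composing with \<open>f\<close> or its inverse shows that both choices are made from the
  same set.\<close>

lemma tree_rep_eq:
  assumes "port_iso f T T'"
  shows "tree_rep T = tree_rep T'"
proof -
  have "(\<exists>f. port_iso f T R) \<longleftrightarrow> (\<exists>f. port_iso f T' R)" for R :: "'a pgraph"
    using assms port_iso_comp port_iso_inv by metis
  then show ?thesis
    unfolding tree_rep_def by simp
qed

lemma candidates_view_iso:
  assumes "view_iso V W" "vroot V \<in> verts V"
  shows "candidates V a = candidates W a"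
proof -
  have "view_iso V X \<longleftrightarrow> view_iso W X" for X :: "'a view"
    using assms view_iso_sym view_iso_trans by blast
  then show ?thesis
    unfolding candidates_def by simp
qed

lemma anonymous_elect: "anonymous_algorithm elect"
  unfolding anonymous_algorithm_def
proof (intro allI impI, elim conjE)
  fix T T' :: "'a pgraph" and v v' r r' a
  assume "v \<in> verts T" "view_iso (view_of T v r) (view_of T' v' r')"
  then have "candidates (view_of T v r) a = candidates (view_of T' v' r') a"
    by (intro candidates_view_iso) (simp_all add: tdist_self)
  then show "elect (view_of T v r) a = elect (view_of T' v' r') a"
    by (simp add: elect_def)
qed

text \<open>Following \<open>f\<close> by the inverse of \<open>g\<close> gives an automorphism of
  \<open>T\<close>, which fixes every vertex.\<close>

lemma rigid_port_iso_eq: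
  assumes "\<not> symmetric_tree T" "port_iso f T R" "port_iso g T R" "v \<in> verts T"
  shows "f v = g v"
proof -
  have "port_iso (inv_into (verts T) g \<circ> f) T T"
    using assms(2,3) port_iso_comp port_iso_inv by blast
  then have "inv_into (verts T) g (f v) = v"
    using assms(1,4) by (auto simp: symmetric_tree_def)
  moreover have "f v \<in> verts R" "bij_betw g (verts T) (verts R)"
    using assms(2-4) by (auto simp: port_iso_def bij_betwE)
  ultimately show ?thesis
    using bij_betw_inv_into_right by metis
qed

text \<open>No node can be misled, even in an early round: the advice determines the diameter, a
  matching view extends to an isomorphism onto \<open>R\<close> taking \<open>v\<close> to
  \<open>w\<close>, and rigidity identifies it with \<open>h\<close>.\<close>

lemma candidates_subset:
  assumes T: "ported_tree T" "\<not> symmetric_tree T" and h: "port_iso h T (tree_rep T)"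
    and v: "v \<in> verts T" and r: "r \<le> diam T - 1"
  shows "candidates (view_of T v r) (binary (diam T)) \<subseteq> {(tree_rep T, h v)}"
proof clarify
  fix R w assume "(R, w) \<in> candidates (view_of T v r) (binary (diam T))"
  then have R: "ported_tree R" "tree_rep R = R" "w \<in> verts R" "diam R = diam T"
    "view_iso (view_of T v r) (view_of R w (diam T - 1))"
    by (auto simp: candidates_def dest!: binary_inj)
  obtain g where g: "port_iso g T R" "g v = w"
    using view_iso_rooted_port_iso[OF T(1) R(1,4) v R(3) r R(5)] .
  then have "R = tree_rep T"
    using tree_rep_eq R(2) by metis
  then show "R = tree_rep T \<and> w = h v"
    using rigid_port_iso_eq[OF T(2) _ h v] g by metis
qed

text \<open>This guarantees halting: in round \<open>diam T - 1\<close> the true position is itself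
  a candidate, with \<open>h\<close> providing the view isomorphism.\<close>

lemma candidates_final:
  assumes T: "ported_tree T" and h: "port_iso h T (tree_rep T)" and v: "v \<in> verts T"
  shows "(tree_rep T, h v) \<in> candidates (view_of T v (diam T - 1)) (binary (diam T))"
proof -
  note R = tree_rep_iso(1)[OF T]
  have "h v \<in> verts (tree_rep T)"
    using h v by (auto simp: port_iso_def bij_betwE)
  then show ?thesis
    using R tree_rep_eq[OF h] port_iso_diam[OF T R h] port_iso_view_iso[OF T R h v]
    by (simp add: candidates_def)
qed

lemma elect_works_in_time:
  assumes "ported_tree T"
  shows "works_in_time elect (binary (diam T)) T (diam T - 1)"
proof -
  obtain h where "port_iso h T (tree_rep T)"
    using tree_rep_iso(2)[OF assms] by blast
  then have "elect (view_of T v (diam T - 1)) (binary (diam T)) \<noteq> None" if "v \<in> verts T" for v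
    using candidates_final[OF assms] that by (fastforce simp: elect_def)
  then show ?thesis
    unfolding works_in_time_def by blast
qed

lemma elect_output_eq:
  assumes T: "ported_tree T" "\<not> symmetric_tree T" and h: "port_iso h T (tree_rep T)"
    and v: "v \<in> verts T"
  shows "elect_output elect (binary (diam T)) T v = path_to_leader (tree_rep T) (h v)"
proof -
  let ?a = "binary (diam T)"
  let ?r = "halting_round elect ?a T v"
  obtain s where s: "s \<le> diam T - 1" "elect (view_of T v s) ?a \<noteq> None"
    using elect_works_in_time[OF T(1)] v by (auto simp: works_in_time_def)
  have halts: "elect (view_of T v ?r) ?a \<noteq> None"
    unfolding halting_round_def using s(2) by (rule LeastI)
  \<comment> \<open>The node may halt before round \<open>diam T - 1\<close>, but never later, so
    its candidate set is nonempty and within the singleton.\<close>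
  have "?r \<le> s"
    unfolding halting_round_def using s(2) by (rule Least_le)
  then have "candidates (view_of T v ?r) ?a \<subseteq> {(tree_rep T, h v)}"
    using candidates_subset[OF T h v] s(1) by simp
  then have "candidates (view_of T v ?r) ?a = {(tree_rep T, h v)}"
    using halts by (auto simp: elect_def split: if_splits)
  then show ?thesis
    by (simp add: elect_output_def elect_def)
qed

lemma elect_solves_election:
  assumes T: "ported_tree T" "\<not> symmetric_tree T"
  shows "solves_election elect (binary (diam T)) T"
proof -
  let ?R = "tree_rep T"
  let ?l = "SOME l. l \<in> verts ?R"
  note R = tree_rep_iso(1)[OF T(1)]
  obtain h where h: "port_iso h T ?R"
    using tree_rep_iso(2)[OF T(1)] by blast
  \<comment> \<open>\<open>k\<close> leads back from the representative; the leader elected in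
    \<open>T\<close> is \<open>k ?l\<close>.\<close>
  define k where "k = inv_into (verts T) h"
  have k: "port_iso k ?R T"
    unfolding k_def using h by (rule port_iso_inv)
  have l: "?l \<in> verts ?R"
    using R by (auto simp: ported_tree_def intro: someI)
  have "\<exists>xs. port_path T v (elect_output elect (binary (diam T)) T v) xs \<and> distinct xs \<and> last xs = k ?l"
    if v: "v \<in> verts T" for v
  proof -
    have hv: "h v \<in> verts ?R" "k (h v) = v"
      using h v unfolding k_def by (auto simp: port_iso_def bij_betwE bij_betw_inv_into_left)
    let ?ps = "path_to_leader ?R (h v)"
    have "\<exists>xs. port_path ?R (h v) ?ps xs \<and> distinct xs \<and> last xs = ?l"
      unfolding path_to_leader_def using ex_port_path[OF R hv(1) l] by (rule someI_ex)
    then obtain xs where xs: "port_path ?R (h v) ?ps xs" "distinct xs" "last xs = ?l"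
      by blast
    then have "tree_path ?R (h v) ?l xs"
      by (simp add: port_path_def tree_path_def)
    then have "tree_path T v (k ?l) (map k xs)"
      using port_iso_tree_path[OF k] hv(2) by metis
    then show ?thesis
      using port_path_iso[OF k xs(1)] elect_output_eq[OF T h v] hv(2)
      by (auto simp: tree_path_def)
  qed
  moreover have "k ?l \<in> verts T"
    using k l by (auto simp: port_iso_def bij_betwE)
  ultimately show ?thesis
    unfolding solves_election_def leader_election_def by blast
qed

text \<open>Isomorphic views of radius \<open>diam T - 1\<close> in one tree yield an automorphism
  moving one root to the other, so the roots coincide. Hence any outputs depend only on these views,
  in particular those of \<open>elect\<close>.\<close>

lemma xi_le_diam:
  assumes T: "ported_tree T" "\<not> symmetric_tree T"
  shows "xi T \<le> enat (diam T - 1)"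
proof -
  have "u = v" if uv: "u \<in> verts T" "v \<in> verts T"
      "view_iso (view_of T u (diam T - 1)) (view_of T v (diam T - 1))" for u v
  proof -
    obtain g where "port_iso g T T" "g u = v"
      using view_iso_extend[OF T(1) T(1) refl uv] .
    then show ?thesis
      using rigid_port_iso_eq[OF T(2) port_iso_id _ uv(1), of g] by simp
  qed
  then have "election_feasible T (diam T - 1)"
    using elect_solves_election[OF T] unfolding election_feasible_def solves_election_def
    by blast
  then show ?thesis
    unfolding xi_def by (intro Inf_lower) blast
qed

theorem mainTheorem1:
  shows "(\<exists>(alg :: nat algorithm) (A :: nat pgraph \<Rightarrow> bool list) (C :: real).
            anonymous_algorithm alg \<and> anonymous_oracle A \<and>
            (\<forall>(D :: nat) (T :: nat pgraph).
               D \<ge> 2 \<and> ported_tree T \<and> \<not> symmetric_tree T \<and> card (verts T) \<ge> 2 \<and> diam T \<le> D \<longrightarrow>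
               works_in_time alg (A T) T (diam T - 1) \<and>
               solves_election alg (A T) T \<and>
               real (length (A T)) \<le> C * log 2 (real D)))
         \<and> (\<forall>T :: nat pgraph.
               ported_tree T \<and> \<not> symmetric_tree T \<and> card (verts T) \<ge> 2 \<longrightarrow>
               xi T \<le> enat (diam T - 1))"
proof (intro conjI exI[of _ elect] exI[of _ "\<lambda>T. binary (diam T)"] exI[of _ 2] allI impI)
  show "anonymous_algorithm elect"
    by (rule anonymous_elect)
  show "anonymous_oracle (\<lambda>T :: nat pgraph. binary (diam T))"
    unfolding anonymous_oracle_def by (metis port_iso_diam)
qed (simp_all add: elect_works_in_time elect_solves_election length_binary_le_log xi_le_diam
    del: One_nat_def)

end
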